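(* Let $n \geq 1$ be an integer. The binomial measures $(b_{n,t})_{t\in[0,1]}$ satisfy: (1) $b_{n,0} = \delta_0$ and $b_{n,1} = \delta_n$ (point masses at $0$ and $n$ respectively); (2) for every function $f : \mathbb{Z} \to \mathbb{R}$ and every $t\in[0,1]$, $$\frac{\partial}{\partial t} \sum_{k \in \mathbb{Z}} f(k)\, b_{n,t}(k) = n \sum_{k \in \mathbb{Z}} (\nabla_n f)(k)\, b_{n,t}(k).$$
   Context: For an integer $n\ge 1$ and $t\in[0,1]$, the binomial measure is $b_{n,t}(k) = \binom{n}{k} t^k (1-t)^{n-k}$ for $k \in\{0,\dots,n\}$ (with $0^0=1$), and $b_{n,t}(k)=0$ for $k\in\mathbb{Z}\setminus\{0,\dots,n\}$. The finite difference operator $\nabla_n$ is defined by $$(\nabla_n f)(k) = \frac{k}{n}\bigl(f(k)-f(k-1)\bigr) + \frac{n-k}{n}\bigl(f(k+1)-f(k)\bigr).$$ At the endpoints $t=0,1$ the derivative in $t$ is understood as one-sided. *)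

theory Defs
  imports "HOL-Analysis.Analysis"
begin

text \<open>
  A measure on the integers is represented by its mass function of type \<^typ>\<open>int \<Rightarrow> real\<close>.
  The powers have exponents in \<^typ>\<open>nat\<close>, for which \<^prop>\<open>(0::real) ^ 0 = 1\<close> holds.
\<close>

definition binomial_measure :: "nat \<Rightarrow> real \<Rightarrow> int \<Rightarrow> real" where
  "binomial_measure n t k =
     (if k \<in> {0..int n}
      then real (n choose nat k) * t ^ nat k * (1 - t) ^ nat (int n - k)
      else 0)"

definition point_mass :: "int \<Rightarrow> int \<Rightarrow> real" where
  "point_mass a k = (if k = a then 1 else 0)"

definition nabla :: "nat \<Rightarrow> (int \<Rightarrow> real) \<Rightarrow> int \<Rightarrow> real" where
  "nabla n f k =
     real_of_int k / real n * (f k - f (k - 1)) +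
     real_of_int (int n - k) / real n * (f (k + 1) - f k)"

end

theory Submission
  imports Defs
begin

text \<open>
  Write \<open>n = m + 1\<close>. Both sides of the differential equation equal
  \<open>n\<close> times the expectation of the forward difference \<open>f (j + 1) - f j\<close> under \<open>b\<^sub>m\<^sub>,\<^sub>t\<close>.

  On the left, the mass function satisfies the transport equation
  \<open>\<partial>\<^sub>t b\<^sub>n\<^sub>,\<^sub>t k = n (b\<^sub>m\<^sub>,\<^sub>t (k - 1) - b\<^sub>m\<^sub>,\<^sub>t k)\<close>
  (lemma \<open>binomial_measure_has_derivative\<close>), and summation by parts moves the difference onto \<open>f\<close>.

  On the right, \<open>\<nabla>\<^sub>n\<close> weights the backward difference by \<open>k / n\<close> and the forward difference by
  \<open>(n - k) / n\<close>. The absorption identities \<open>k b\<^sub>n\<^sub>,\<^sub>t k = n t b\<^sub>m\<^sub>,\<^sub>t (k - 1)\<close> and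
  \<open>(n - k) b\<^sub>n\<^sub>,\<^sub>t k = n (1 - t) b\<^sub>m\<^sub>,\<^sub>t k\<close> turn these weights into the factors \<open>t\<close> and \<open>1 - t\<close> in front
  of the same expectation under \<open>b\<^sub>m\<^sub>,\<^sub>t\<close> (the backward difference being shifted by one), and
  \<open>t + (1 - t) = 1\<close>.
\<close>

lemma binomial_measure_0: "binomial_measure n 0 = point_mass 0"
  by (auto simp: binomial_measure_def point_mass_def fun_eq_iff power_0_left)

lemma binomial_measure_1: "binomial_measure n 1 = point_mass (int n)"
  by (auto simp: binomial_measure_def point_mass_def fun_eq_iff power_0_left)

lemma binomial_measure_of_nat:
  "j \<le> n \<Longrightarrow> binomial_measure n t (int j) = real (n choose j) * t ^ j * (1 - t) ^ (n - j)"
  by (simp add: binomial_measure_def nat_diff_distrib flip: of_nat_diff)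

lemma binomial_measure_eq_0: "k \<notin> {0..int n} \<Longrightarrow> binomial_measure n t k = 0"
  by (auto simp: binomial_measure_def)

lemma infsum_binomial_measure:
  "(\<Sum>\<^sub>\<infinity>k. h k * binomial_measure n t k) = (\<Sum>k\<in>{0..int n}. h k * binomial_measure n t k)"
proof -
  have "(\<Sum>\<^sub>\<infinity>k. h k * binomial_measure n t k)
      = (\<Sum>\<^sub>\<infinity>k\<in>{0..int n}. h k * binomial_measure n t k)"
    by (rule infsum_cong_neutral) (auto simp: binomial_measure_eq_0)
  then show ?thesis by simp
qed

lemma sum_binomial_measure_enlarge:
  "(\<Sum>k\<in>{0..int (Suc m)}. h k * binomial_measure m t k)
    = (\<Sum>k\<in>{0..int m}. h k * binomial_measure m t k)"
  by (rule sum.mono_neutral_right) (auto simp: binomial_measure_eq_0)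

lemma sum_binomial_measure_shift:
  "(\<Sum>k\<in>{0..int (Suc m)}. h k * binomial_measure m t (k - 1))
    = (\<Sum>j\<in>{0..int m}. h (j + 1) * binomial_measure m t j)"
proof -
  have "(\<Sum>k\<in>{0..int (Suc m)}. h k * binomial_measure m t (k - 1))
      = (\<Sum>k\<in>{1..int (Suc m)}. h k * binomial_measure m t (k - 1))"
    by (rule sum.mono_neutral_right) (auto simp: binomial_measure_eq_0)
  also have "\<dots> = (\<Sum>j\<in>{0..int m}. h (j + 1) * binomial_measure m t j)"
    by (rule sum.reindex_bij_witness[of _ "\<lambda>j. j + 1" "\<lambda>k. k - 1"]) auto
  finally show ?thesis .
qed

lemma of_nat_choose_absorb_lower:
  "real (Suc i) * real (Suc m choose Suc i) = real (Suc m) * real (m choose i)"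
  by (metis Suc_times_binomial of_nat_mult)

lemma of_nat_choose_absorb_upper:
  "real (Suc m - j) * real (Suc m choose j) = real (Suc m) * real (m choose j)"
  using binomial_absorb_comp[of "Suc m" j] by (metis diff_Suc_1 of_nat_mult)

lemma binomial_measure_absorb_lower:
  "of_int k * binomial_measure (Suc m) t k = real (Suc m) * t * binomial_measure m t (k - 1)"
proof (cases "k \<in> {1..int (Suc m)}")
  case True
  define i where "i = nat (k - 1)"
  have k: "k = int (Suc i)" and i: "i \<le> m"
    using True by (auto simp: i_def)
  have "k - 1 = int i" by (simp add: k)
  then have "binomial_measure m t (k - 1) = real (m choose i) * t ^ i * (1 - t) ^ (m - i)"
    using i by (simp only: binomial_measure_of_nat)
  moreover have "binomial_measure (Suc m) t k
      = real (Suc m choose Suc i) * t ^ Suc i * (1 - t) ^ (m - i)"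
    unfolding k using i by (subst binomial_measure_of_nat) auto
  moreover have "of_int k = real (Suc i)" by (simp add: k)
  ultimately show ?thesis
    using of_nat_choose_absorb_lower[of i m] by (simp del: of_nat_Suc binomial_Suc_Suc)
next
  case False
  then show ?thesis by (cases "k = 0") (auto simp: binomial_measure_eq_0)
qed

lemma binomial_measure_absorb_upper:
  "of_int (int (Suc m) - k) * binomial_measure (Suc m) t k
    = real (Suc m) * (1 - t) * binomial_measure m t k"
proof (cases "k \<in> {0..int m}")
  case True
  define j where "j = nat k"
  have k: "k = int j" and j: "j \<le> m"
    using True by (auto simp: j_def)
  have "of_int (int (Suc m) - k) = real (Suc m - j)"
    using j by (simp add: k of_nat_diff)
  with of_nat_choose_absorb_upper[of m j] show ?thesis
    using j by (simp add: k binomial_measure_of_nat Suc_diff_le del: of_nat_Suc binomial_Suc_Suc)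
next
  case False
  then show ?thesis by (cases "k = int (Suc m)") (auto simp: binomial_measure_eq_0)
qed

text \<open>
  In the product rule each of the two terms loses one factor \<open>t\<close> or \<open>1 - t\<close>, and the exponent that
  comes down is absorbed into the binomial coefficient. Dividing the absorption identities for
  \<open>b\<^sub>n\<^sub>,\<^sub>t\<close> by \<open>t\<close> and \<open>1 - t\<close> would exclude the endpoints, so the binomial coefficients are compared
  instead.
\<close>

lemma binomial_measure_has_derivative:
  "((\<lambda>s. binomial_measure (Suc m) s k) has_real_derivative
     real (Suc m) * (binomial_measure m t (k - 1) - binomial_measure m t k)) (at t within A)"
proof (cases "k \<in> {0..int (Suc m)}")
  case True
  define j where "j = nat k"
  have k: "k = int j" and j: "j \<le> Suc m"
    using True by (auto simp: j_def)
  let ?c = "real (Suc m choose j)"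
  have lower: "?c * (real j * t ^ (j - 1)) * (1 - t) ^ (Suc m - j)
      = real (Suc m) * binomial_measure m t (k - 1)"
  proof (cases j)
    case 0
    then show ?thesis by (simp add: k binomial_measure_eq_0)
  next
    case (Suc i)
    have "k - 1 = int i" by (simp add: k Suc)
    with of_nat_choose_absorb_lower[of i m] show ?thesis
      using j by (simp add: Suc binomial_measure_of_nat mult.commute
          del: of_nat_Suc binomial_Suc_Suc)
  qed
  have upper: "?c * t ^ j * (real (Suc m - j) * (1 - t) ^ (Suc m - j - 1))
      = real (Suc m) * binomial_measure m t k"
  proof (cases "j \<le> m")
    case True
    with of_nat_choose_absorb_upper[of m j] show ?thesis
      by (simp add: k binomial_measure_of_nat mult.commute del: of_nat_Suc binomial_Suc_Suc)
  next
    case False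
    then show ?thesis using j by (simp add: k binomial_measure_eq_0)
  qed
  have "((\<lambda>s. ?c * s ^ j * (1 - s) ^ (Suc m - j)) has_real_derivative
      ?c * (real j * t ^ (j - 1)) * (1 - t) ^ (Suc m - j)
      - ?c * t ^ j * (real (Suc m - j) * (1 - t) ^ (Suc m - j - 1))) (at t within A)"
    by (auto intro!: derivative_eq_intros simp: algebra_simps)
  then have "((\<lambda>s. ?c * s ^ j * (1 - s) ^ (Suc m - j)) has_real_derivative
      real (Suc m) * (binomial_measure m t (k - 1) - binomial_measure m t k)) (at t within A)"
    unfolding lower upper by (simp only: right_diff_distrib)
  then show ?thesis
    using j by (simp only: k binomial_measure_of_nat)
next
  case False
  then have "binomial_measure m t (k - 1) = 0" "binomial_measure m t k = 0"
    by (auto intro!: binomial_measure_eq_0)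
  with False show ?thesis by (simp add: binomial_measure_eq_0)
qed

lemma binomial_expectation_has_derivative:
  "((\<lambda>s. \<Sum>k\<in>{0..int (Suc m)}. f k * binomial_measure (Suc m) s k) has_real_derivative
     real (Suc m) * (\<Sum>j\<in>{0..int m}. (f (j + 1) - f j) * binomial_measure m t j)) (at t within A)"
proof -
  let ?K = "{0..int (Suc m)}"
  have "((\<lambda>s. \<Sum>k\<in>?K. f k * binomial_measure (Suc m) s k) has_real_derivative
      (\<Sum>k\<in>?K. f k * (real (Suc m) * (binomial_measure m t (k - 1) - binomial_measure m t k))))
      (at t within A)"
    by (intro DERIV_sum DERIV_cmult binomial_measure_has_derivative)
  also have "(\<Sum>k\<in>?K. f k * (real (Suc m) * (binomial_measure m t (k - 1) - binomial_measure m t k)))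
      = real (Suc m) * ((\<Sum>k\<in>?K. f k * binomial_measure m t (k - 1))
          - (\<Sum>k\<in>?K. f k * binomial_measure m t k))"
    by (simp only: sum_distrib_left right_diff_distrib sum_subtractf mult.left_commute)
  also have "\<dots> = real (Suc m) * (\<Sum>j\<in>{0..int m}. (f (j + 1) - f j) * binomial_measure m t j)"
    by (simp only: sum_binomial_measure_shift sum_binomial_measure_enlarge
        left_diff_distrib sum_subtractf)
  finally show ?thesis .
qed

lemma binomial_expectation_nabla:
  "(\<Sum>k\<in>{0..int (Suc m)}. nabla (Suc m) f k * binomial_measure (Suc m) t k)
    = (\<Sum>j\<in>{0..int m}. (f (j + 1) - f j) * binomial_measure m t j)"
proof -
  let ?K = "{0..int (Suc m)}"
  let ?S = "\<Sum>j\<in>{0..int m}. (f (j + 1) - f j) * binomial_measure m t j"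
  have "nabla (Suc m) f k * binomial_measure (Suc m) t k
      = t * ((f k - f (k - 1)) * binomial_measure m t (k - 1))
        + (1 - t) * ((f (k + 1) - f k) * binomial_measure m t k)" for k
  proof -
    have "nabla (Suc m) f k * binomial_measure (Suc m) t k
        = (of_int k * binomial_measure (Suc m) t k) / real (Suc m) * (f k - f (k - 1))
          + (of_int (int (Suc m) - k) * binomial_measure (Suc m) t k) / real (Suc m)
            * (f (k + 1) - f k)"
      unfolding nabla_def by (simp add: field_simps del: of_nat_Suc of_int_diff)
    also have "\<dots> = t * ((f k - f (k - 1)) * binomial_measure m t (k - 1))
        + (1 - t) * ((f (k + 1) - f k) * binomial_measure m t k)"
      unfolding binomial_measure_absorb_lower binomial_measure_absorb_upper
      by (simp del: of_nat_Suc)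
    finally show ?thesis .
  qed
  then have "(\<Sum>k\<in>?K. nabla (Suc m) f k * binomial_measure (Suc m) t k)
      = t * (\<Sum>k\<in>?K. (f k - f (k - 1)) * binomial_measure m t (k - 1))
        + (1 - t) * (\<Sum>k\<in>?K. (f (k + 1) - f k) * binomial_measure m t k)"
    by (simp only: sum.distrib sum_distrib_left)
  also have "\<dots> = t * ?S + (1 - t) * ?S"
    unfolding sum_binomial_measure_shift sum_binomial_measure_enlarge by simp
  finally show ?thesis by (simp add: algebra_simps)
qed

theorem theorem1p2:
  fixes n :: nat
  assumes "n \<ge> 1"
  shows "binomial_measure n 0 = point_mass 0 \<and>
         binomial_measure n 1 = point_mass (int n) \<and>
         (\<forall>f :: int \<Rightarrow> real. \<forall>t \<in> {0..1}.
            ((\<lambda>s. \<Sum>\<^sub>\<infinity>k. f k * binomial_measure n s k) has_real_derivative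
              real n * (\<Sum>\<^sub>\<infinity>k. nabla n f k * binomial_measure n t k))
            (at t within {0..1}))"
proof -
  obtain m where n: "n = Suc m"
    using assms by (cases n) auto
  have "((\<lambda>s. \<Sum>\<^sub>\<infinity>k. f k * binomial_measure n s k) has_real_derivative
      real n * (\<Sum>\<^sub>\<infinity>k. nabla n f k * binomial_measure n t k)) (at t within {0..1})"
    for f :: "int \<Rightarrow> real" and t
    unfolding infsum_binomial_measure n binomial_expectation_nabla
    by (rule binomial_expectation_has_derivative)
  then show ?thesis
    using binomial_measure_0 binomial_measure_1 by blast
qed

end
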